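(* Let $\sigma>0$, and let $\mathcal S_1:\mathcal X\to\mathcal X$ and $\mathcal S_2:\mathcal Y\to\mathcal Y$ be two self-adjoint positive semi-definite linear operators such that $\partial f(\cdot)+\sigma\mathcal F^*\mathcal F+\mathcal S_1$ and $\partial g(\cdot)+\sigma\mathcal G^*\mathcal G+\mathcal S_2$ are maximal and strongly monotone, respectively. Consider $(x^0,y^0,z^0)\in\operatorname{dom}(f)\times\operatorname{dom}(g)\times\mathcal Z$ and $\rho\in\mathbb R$. Then the point $(x^+,y^+,z^+)$ generated by the generalized semi-proximal ADMM scheme $$\left\{\begin{aligned} \bar x^+&=\operatorname*{argmin}_x\ \mathcal L_\sigma(x,y^0;z^0)+\tfrac12\|x-x^0\|_{\mathcal S_1}^2,\\ \bar z^+&=z^0+\sigma(\mathcal F\bar x^++\mathcal G y^0-c),\\ \bar y^+&=\operatorname*{argmin}_y\ \mathcal L_\sigma(\bar x^+,y;\bar z^+)+\tfrac12\|y-y^0\|_{\mathcal S_2}^2,\\ (x^+,y^+,z^+)&=(1-\rho)(x^0,y^0,z^0)+\rho(\bar x^+,\bar y^+,\bar z^+) \end{aligned}\right.$$ is equivalent to (i.e. coincides with) the one generated by the proximal point scheme $$\left\{\begin{aligned} &0\in\mathcal T_l(\bar x^+,\bar y^+,\bar z^+)+\mathcal S(\bar x^+-x^0,\bar y^+-y^0,\bar z^+-z^0),\\ &(x^+,y^+,z^+)=(1-\rho)(x^0,y^0,z^0)+\rho(\bar x^+,\bar y^+,\bar z^+). \end{aligned}\right.$$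
   Context: $\mathcal X,\mathcal Y,\mathcal Z$ are real finite-dimensional Euclidean spaces, each with an inner product $\langle\cdot,\cdot\rangle$ and induced norm $\|\cdot\|$. $f:\mathcal X\to(-\infty,+\infty]$ and $g:\mathcal Y\to(-\infty,+\infty]$ are proper closed convex functions, $\mathcal F:\mathcal X\to\mathcal Z$ and $\mathcal G:\mathcal Y\to\mathcal Z$ are linear operators with adjoints $\mathcal F^*,\mathcal G^*$, and $c\in\mathcal Z$. The problem is $\min_{x,y}\{f(x)+g(y):\mathcal Fx+\mathcal Gy=c\}$. Its augmented Lagrangian is $$\mathcal L_\sigma(x,y;z)=f(x)+g(y)+\langle z,\mathcal Fx+\mathcal Gy-c\rangle+\tfrac\sigma2\|\mathcal Fx+\mathcal Gy-c\|^2.$$ The (set-valued) KKT operator is $$\mathcal T_l(x,y,z)=\begin{pmatrix}\partial f(x)+\mathcal F^*z\\ \partial g(y)+\mathcal G^*z\\ c-\mathcal Fx-\mathcal Gy\end{pmatrix},$$ where $\partial$ denotes the convex subdifferential. Standing assumption: the KKT system $0\in\mathcal T_l(x,y,z)$ has a nonempty solution set. The self-adjoint linear operator $\mathcal S$ on $\mathcal X\times\mathcal Y\times\mathcal Z$ is $$\mathcal S=\begin{pmatrix}\mathcal S_1&0&0\\0&\sigma\mathcal G^*\mathcal G+\mathcal S_2&\mathcal G^*\\0&\mathcal G&\sigma^{-1}\mathcal I\end{pmatrix},$$ with $\mathcal I$ the identity on $\mathcal Z$. For a self-adjoint positive semi-definite operator $\mathcal P$, $\|x\|_{\mathcal P}=\sqrt{\langle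 x,\mathcal Px\rangle}$. *)

theory Defs
  imports "HOL-Analysis.Analysis"
begin

definition effective_domain :: "('a \<Rightarrow> ereal) \<Rightarrow> 'a set" where
  "effective_domain f = {x. f x < \<infinity>}"

definition proper_fun :: "('a \<Rightarrow> ereal) \<Rightarrow> bool" where
  "proper_fun f \<longleftrightarrow> (\<forall>x. f x \<noteq> -\<infinity>) \<and> effective_domain f \<noteq> {}"

definition ext_epigraph :: "('a \<Rightarrow> ereal) \<Rightarrow> ('a \<times> real) set" where
  "ext_epigraph f = {(x, t). f x \<le> ereal t}"

definition proper_closed_convex :: "('a::euclidean_space \<Rightarrow> ereal) \<Rightarrow> bool" where
  "proper_closed_convex f \<longleftrightarrow>
     proper_fun f \<and> closed (ext_epigraph f) \<and> convex (ext_epigraph f)"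

text \<open>For a proper function the subdifferential is automatically empty outside the
  effective domain.\<close>

definition subdifferential :: "('a::real_inner \<Rightarrow> ereal) \<Rightarrow> 'a \<Rightarrow> 'a set" where
  "subdifferential f x = {v. \<forall>y. f x + ereal (v \<bullet> (y - x)) \<le> f y}"

definition argmin_set :: "('a \<Rightarrow> ereal) \<Rightarrow> 'a set" where
  "argmin_set h = {x. is_arg_min h (\<lambda>_. True) x}"

definition monotone_operator :: "('a::real_inner \<Rightarrow> 'a set) \<Rightarrow> bool" where
  "monotone_operator A \<longleftrightarrow>
     (\<forall>x y. \<forall>u\<in>A x. \<forall>v\<in>A y. 0 \<le> (u - v) \<bullet> (x - y))"

definition maximal_monotone :: "('a::real_inner \<Rightarrow> 'a set) \<Rightarrow> bool" where
  "maximal_monotone A \<longleftrightarrow> monotone_operator A \<and>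
     (\<forall>B. monotone_operator B \<and> (\<forall>x. A x \<subseteq> B x) \<longrightarrow> B = A)"

definition strongly_monotone :: "('a::real_inner \<Rightarrow> 'a set) \<Rightarrow> bool" where
  "strongly_monotone A \<longleftrightarrow>
     (\<exists>\<mu>>0. \<forall>x y. \<forall>u\<in>A x. \<forall>v\<in>A y. \<mu> * (norm (x - y))\<^sup>2 \<le> (u - v) \<bullet> (x - y))"

definition selfadjoint_psd :: "('a::euclidean_space \<Rightarrow> 'a) \<Rightarrow> bool" where
  "selfadjoint_psd P \<longleftrightarrow> linear P \<and> adjoint P = P \<and> (\<forall>x. 0 \<le> x \<bullet> P x)"

definition op_norm :: "('a::real_inner \<Rightarrow> 'a) \<Rightarrow> 'a \<Rightarrow> real" where
  "op_norm P x = sqrt (x \<bullet> P x)"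

definition aug_lagrangian ::
  "('a::euclidean_space \<Rightarrow> ereal) \<Rightarrow> ('b::euclidean_space \<Rightarrow> ereal) \<Rightarrow>
   ('a \<Rightarrow> 'c::euclidean_space) \<Rightarrow> ('b \<Rightarrow> 'c) \<Rightarrow> 'c \<Rightarrow> real \<Rightarrow> 'a \<Rightarrow> 'b \<Rightarrow> 'c \<Rightarrow> ereal" where
  "aug_lagrangian f g F G c \<sigma> x y z =
     f x + g y + ereal (z \<bullet> (F x + G y - c) + \<sigma> / 2 * (norm (F x + G y - c))\<^sup>2)"

definition kkt_operator ::
  "('a::euclidean_space \<Rightarrow> ereal) \<Rightarrow> ('b::euclidean_space \<Rightarrow> ereal) \<Rightarrow>
   ('a \<Rightarrow> 'c::euclidean_space) \<Rightarrow> ('b \<Rightarrow> 'c) \<Rightarrow> 'c \<Rightarrow> 'a \<times> 'b \<times> 'c \<Rightarrow> ('a \<times> 'b \<times> 'c) set" where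
  "kkt_operator f g F G c = (\<lambda>(x, y, z).
     {(u + adjoint F z, v + adjoint G z, c - F x - G y) | u v.
        u \<in> subdifferential f x \<and> v \<in> subdifferential g y})"

definition prox_metric ::
  "('b::euclidean_space \<Rightarrow> 'c::euclidean_space) \<Rightarrow> real \<Rightarrow> ('a::euclidean_space \<Rightarrow> 'a) \<Rightarrow>
   ('b \<Rightarrow> 'b) \<Rightarrow> 'a \<times> 'b \<times> 'c \<Rightarrow> 'a \<times> 'b \<times> 'c" where
  "prox_metric G \<sigma> S1 S2 = (\<lambda>(x, y, z).
     (S1 x,
      \<sigma> *\<^sub>R adjoint G (G y) + S2 y + adjoint G z,
      G y + (1 / \<sigma>) *\<^sub>R z))"

text \<open>In both schemes below, \<open>w0\<close> is the current point \<open>(x0, y0, z0)\<close>, \<open>wb\<close> the intermediate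
  (barred) triple and \<open>wp\<close> the relaxed new point.  Writing the argmin steps as
  \<open>argmin_set _ = {_}\<close> demands that the subproblem has exactly one minimizer.\<close>

definition gsp_admm_step ::
  "('a::euclidean_space \<Rightarrow> ereal) \<Rightarrow> ('b::euclidean_space \<Rightarrow> ereal) \<Rightarrow>
   ('a \<Rightarrow> 'c::euclidean_space) \<Rightarrow> ('b \<Rightarrow> 'c) \<Rightarrow> 'c \<Rightarrow> real \<Rightarrow> ('a \<Rightarrow> 'a) \<Rightarrow> ('b \<Rightarrow> 'b) \<Rightarrow> real \<Rightarrow>
   'a \<times> 'b \<times> 'c \<Rightarrow> 'a \<times> 'b \<times> 'c \<Rightarrow> 'a \<times> 'b \<times> 'c \<Rightarrow> bool" where
  "gsp_admm_step f g F G c \<sigma> S1 S2 \<rho> w0 wb wp \<longleftrightarrow>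
     (case (w0, wb) of ((x0, y0, z0), (xb, yb, zb)) \<Rightarrow>
        argmin_set (\<lambda>x. aug_lagrangian f g F G c \<sigma> x y0 z0
                        + ereal (1 / 2 * (op_norm S1 (x - x0))\<^sup>2)) = {xb} \<and>
        zb = z0 + \<sigma> *\<^sub>R (F xb + G y0 - c) \<and>
        argmin_set (\<lambda>y. aug_lagrangian f g F G c \<sigma> xb y zb
                        + ereal (1 / 2 * (op_norm S2 (y - y0))\<^sup>2)) = {yb}) \<and>
     wp = (1 - \<rho>) *\<^sub>R w0 + \<rho> *\<^sub>R wb"

definition prox_point_step ::
  "('a::euclidean_space \<Rightarrow> ereal) \<Rightarrow> ('b::euclidean_space \<Rightarrow> ereal) \<Rightarrow>
   ('a \<Rightarrow> 'c::euclidean_space) \<Rightarrow> ('b \<Rightarrow> 'c) \<Rightarrow> 'c \<Rightarrow> real \<Rightarrow> ('a \<Rightarrow> 'a) \<Rightarrow> ('b \<Rightarrow> 'b) \<Rightarrow> real \<Rightarrow>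
   'a \<times> 'b \<times> 'c \<Rightarrow> 'a \<times> 'b \<times> 'c \<Rightarrow> 'a \<times> 'b \<times> 'c \<Rightarrow> bool" where
  "prox_point_step f g F G c \<sigma> S1 S2 \<rho> w0 wb wp \<longleftrightarrow>
     0 \<in> (\<lambda>t. t + prox_metric G \<sigma> S1 S2 (wb - w0)) ` kkt_operator f g F G c wb \<and>
     wp = (1 - \<rho>) *\<^sub>R w0 + \<rho> *\<^sub>R wb"

end

theory Submission
  imports Defs
begin

text \<open>The optimality condition of each subproblem is an inclusion \<open>- (H x + b) \<in> \<partial>f x\<close> with \<open>H\<close>
  positive semidefinite, and substituting the multiplier update turns the two conditions and the
  update into the three blocks of the proximal point inclusion.  Only solvability is not algebra:
  the proximal map of \<open>f + \<langle>\<cdot>, H \<cdot>\<rangle> / 2 + \<langle>b, \<cdot>\<rangle>\<close> is defined everywhere, because a subgradient (which the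
  KKT point supplies) minorizes \<open>f\<close> and strong monotonicity makes it a contraction, so Banach's
  theorem yields a solution.\<close>

section \<open>Convex analysis: optimality conditions, attainment, and solvability of the
  regularized inclusion\<close>

lemma ext_epigraph_convexD:
  assumes "convex (ext_epigraph f)" "f x \<le> ereal s" "f y \<le> ereal t" "0 \<le> a" "a \<le> 1"
  shows "f ((1 - a) *\<^sub>R x + a *\<^sub>R y) \<le> ereal ((1 - a) * s + a * t)"
proof -
  have "(x, s) \<in> ext_epigraph f" "(y, t) \<in> ext_epigraph f"
    using assms by (auto simp: ext_epigraph_def)
  then have "(1 - a) *\<^sub>R (x, s) + a *\<^sub>R (y, t) \<in> ext_epigraph f"
    using assms by (intro convexD) auto
  then show ?thesis by (simp add: ext_epigraph_def)
qed

lemma proper_finite_on_subdifferential: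
  assumes "proper_fun f" "v \<in> subdifferential f x"
  obtains r where "f x = ereal r"
proof -
  obtain y where y: "f y < \<infinity>"
    using assms by (auto simp: proper_fun_def effective_domain_def)
  have "f x + ereal (v \<bullet> (y - x)) \<le> f y"
    using assms by (auto simp: subdifferential_def)
  with y have "f x \<noteq> \<infinity>" by auto
  moreover have "f x \<noteq> -\<infinity>" using assms by (auto simp: proper_fun_def)
  ultimately show ?thesis using that by (cases "f x") auto
qed

lemma proper_finite_on_minimizers:
  fixes q :: "'a \<Rightarrow> real"
  assumes "proper_fun f" "\<And>y. f x + ereal (q x) \<le> f y + ereal (q y)"
  obtains r where "f x = ereal r"
proof -
  obtain y where y: "f y < \<infinity>"
    using assms by (auto simp: proper_fun_def effective_domain_def)
  have "f x \<noteq> \<infinity>" using y assms(2)[of y] by auto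
  moreover have "f x \<noteq> -\<infinity>" using assms by (auto simp: proper_fun_def)
  ultimately show ?thesis using that by (cases "f x") auto
qed

text \<open>The quadratic \<open>q\<close> is given through its exact expansion at \<open>x\<close>,
  with slope \<open>d x\<close> and Hessian \<open>H\<close>. A subgradient \<open>- d x\<close>
  makes \<open>x\<close> minimal because \<open>q\<close> lies above its tangent. Conversely, a step
  of fraction \<open>t\<close> from \<open>x\<close> towards \<open>y\<close> changes the tangent
  and \<open>f\<close> parts by at most first order in \<open>t\<close> and the Hessian part by
  order \<open>t\<close> squared, so dividing by \<open>t\<close> and letting it shrink leaves the
  subgradient inequality.\<close>

lemma minimizer_iff_subgradient:
  fixes f :: "'a::real_inner \<Rightarrow> ereal" and d H :: "'a \<Rightarrow> 'a"
  assumes f: "proper_fun f" "convex (ext_epigraph f)"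
    and H: "linear H" "\<And>x. 0 \<le> x \<bullet> H x"
    and q: "\<And>y. q y = q x + d x \<bullet> (y - x) + 1 / 2 * ((y - x) \<bullet> H (y - x))"
  shows "(\<forall>y. f x + ereal (q x) \<le> f y + ereal (q y)) \<longleftrightarrow> - d x \<in> subdifferential f x"
proof
  assume min: "\<forall>y. f x + ereal (q x) \<le> f y + ereal (q y)"
  obtain r where r: "f x = ereal r"
    using proper_finite_on_minimizers[of f x q] f(1) min by auto
  have "f x + ereal (- d x \<bullet> (y - x)) \<le> f y" for y
  proof (cases "f y")
    case (real s)
    let ?K = "1 / 2 * ((y - x) \<bullet> H (y - x))"
    have "r - d x \<bullet> (y - x) \<le> s + e" if e: "e > 0" for e
    proof -
      \<comment> \<open>Small enough that the second-order remainder \<open>t * ?K\<close> is at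
        most \<open>e\<close>. The added 1 keeps the denominator positive when \<open>?K\<close>
        vanishes, and the minimum with 1 keeps \<open>z\<close> on the segment.\<close>
      define t where "t = min 1 (e / (?K + 1))"
      have K: "?K \<ge> 0" using H(2) by simp
      have t: "0 < t" "t \<le> 1" using e K by (auto simp: t_def)
      have "t \<le> e / (?K + 1)" by (simp add: t_def)
      then have "t * ?K + t \<le> e" using K by (simp add: field_simps)
      then have tK: "t * ?K \<le> e" using t by linarith
      define z where "z = (1 - t) *\<^sub>R x + t *\<^sub>R y"
      have "f z \<le> ereal ((1 - t) * r + t * s)"
        unfolding z_def using ext_epigraph_convexD[OF f(2)] t r real by simp
      moreover have "ereal (r + q x) \<le> f z + ereal (q z)"
        using min r by (metis plus_ereal.simps(1))
      ultimately have le: "r + q x \<le> (1 - t) * r + t * s + q z"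
        by (cases "f z") auto
      have zx: "z - x = t *\<^sub>R (y - x)" by (simp add: z_def algebra_simps)
      have "q z = q x + t * (d x \<bullet> (y - x)) + t * (t * ?K)"
        by (subst q) (simp add: zx linear_scale[OF H(1)])
      with le have "0 \<le> t * (s - r + d x \<bullet> (y - x) + t * ?K)"
        by (simp add: algebra_simps)
      then have "0 \<le> s - r + d x \<bullet> (y - x) + t * ?K"
        using t by (simp add: zero_le_mult_iff)
      with tK show ?thesis by linarith
    qed
    then have "r - d x \<bullet> (y - x) \<le> s" by (rule field_le_epsilon)
    then show ?thesis by (simp add: r real)
  qed (use f in \<open>auto simp: proper_fun_def\<close>)
  then show "- d x \<in> subdifferential f x"
    by (simp add: subdifferential_def)
next
  assume sub: "- d x \<in> subdifferential f x"
  obtain r where r: "f x = ereal r"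
    using proper_finite_on_subdifferential[OF f(1) sub] .
  show "\<forall>y. f x + ereal (q x) \<le> f y + ereal (q y)"
  proof
    fix y
    have "ereal (r - d x \<bullet> (y - x)) \<le> f y"
      using sub r by (auto simp: subdifferential_def)
    moreover have "q x + d x \<bullet> (y - x) \<le> q y"
      using q[of y] H(2)[of "y - x"] by simp
    ultimately show "f x + ereal (q x) \<le> f y + ereal (q y)"
      by (cases "f y") (auto simp: r)
  qed
qed

text \<open>An affine minorant plus quadratic growth makes the sum coercive. Since \<open>f\<close>
  is only lower semicontinuous and may be infinite, the minimization takes place on its closed
  epigraph, where the objective \<open>t + q x\<close> is continuous.\<close>

lemma affine_minorant_minimizer_exists:
  fixes f :: "'a::euclidean_space \<Rightarrow> ereal" and q :: "'a \<Rightarrow> real"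
  assumes f: "proper_fun f" "closed (ext_epigraph f)"
    and minor: "\<And>x. ereal (\<alpha> + u \<bullet> x) \<le> f x"
    and q: "continuous_on UNIV q" "\<And>x. \<beta> + w \<bullet> x + 1 / 2 * (norm x)\<^sup>2 \<le> q x"
  shows "\<exists>x. \<forall>y. f x + ereal (q x) \<le> f y + ereal (q y)"
proof -
  obtain x1 where "f x1 < \<infinity>"
    using f by (auto simp: proper_fun_def effective_domain_def)
  moreover have "f x1 \<noteq> -\<infinity>" using f by (auto simp: proper_fun_def)
  ultimately obtain r1 where r1: "f x1 = ereal r1" by (cases "f x1") auto
  define M where "M = r1 + q x1"
  \<comment> \<open>The part of the epigraph that does no worse than the point
    \<open>(x1, r1)\<close>.\<close>
  define K where "K = ext_epigraph f \<inter> {p. snd p + q (fst p) \<le> M}"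
  \<comment> \<open>If \<open>norm x\<close> exceeds this bound it is at least 1, so the constant
    term of the quadratic estimate \<open>n\<close> is absorbed into the linear one; cancelling
    \<open>norm x\<close> then contradicts the choice of \<open>B\<close>.\<close>
  define B where "B = 2 * norm (u + w) + 2 * \<bar>M - \<alpha> - \<beta>\<bar> + 1"
  have cont: "continuous_on UNIV (\<lambda>p. snd p + q (fst p))"
    by (intro continuous_intros continuous_on_compose2[OF q(1)]) auto
  have clK: "closed K"
    unfolding K_def by (intro closed_Int f closed_Collect_le cont continuous_intros)
  \<comment> \<open>The height \<open>t\<close> is bounded below by the affine minorant of
    \<open>f\<close> and above by the lower bound on \<open>q\<close>.\<close>
  have bd: "norm x \<le> B \<and> \<bar>t\<bar> \<le> \<bar>M - \<beta>\<bar> + norm w * B + \<bar>\<alpha>\<bar> + norm u * B"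
    if "(x, t) \<in> K" for x t
  proof -
    have tM: "t + q x \<le> M" and ft: "f x \<le> ereal t"
      using that by (auto simp: K_def ext_epigraph_def)
    have at: "\<alpha> + u \<bullet> x \<le> t"
      using order_trans[OF minor ft] by simp
    have "1 / 2 * (norm x)\<^sup>2 \<le> M - \<alpha> - \<beta> - (u + w) \<bullet> x"
      using tM at q(2)[of x] by (simp add: inner_add_left)
    also have "\<dots> \<le> \<bar>M - \<alpha> - \<beta>\<bar> + norm (u + w) * norm x"
      using Cauchy_Schwarz_ineq2[of "u + w" x] by linarith
    finally have n: "norm x * norm x \<le> 2 * \<bar>M - \<alpha> - \<beta>\<bar> + 2 * norm (u + w) * norm x"
      by (simp add: power2_eq_square)
    have xB: "norm x \<le> B"
    proof (rule ccontr)
      assume "\<not> norm x \<le> B"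
      then have gt: "B < norm x" by simp
      moreover have B1: "B \<ge> 1" by (simp add: B_def)
      ultimately have x1: "norm x \<ge> 1" by linarith
      have "2 * \<bar>M - \<alpha> - \<beta>\<bar> * 1 \<le> 2 * \<bar>M - \<alpha> - \<beta>\<bar> * norm x"
        using x1 by (intro mult_left_mono) auto
      with n have "norm x * norm x \<le> (2 * \<bar>M - \<alpha> - \<beta>\<bar> + 2 * norm (u + w)) * norm x"
        by (simp add: algebra_simps)
      then have "norm x \<le> 2 * \<bar>M - \<alpha> - \<beta>\<bar> + 2 * norm (u + w)"
        using x1 by (subst (asm) mult_le_cancel_right) auto
      with gt show False by (simp add: B_def)
    qed
    have ux: "\<bar>u \<bullet> x\<bar> \<le> norm u * B" and wx: "\<bar>w \<bullet> x\<bar> \<le> norm w * B"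
      using Cauchy_Schwarz_ineq2[of _ x] xB by (meson mult_left_mono norm_ge_zero order_trans)+
    have "t \<le> M - \<beta> - w \<bullet> x"
      using tM q(2)[of x] zero_le_power2[of "norm x"] by linarith
    moreover have "0 \<le> norm u * B" "0 \<le> norm w * B" by (auto simp: B_def)
    ultimately have "\<bar>t\<bar> \<le> \<bar>M - \<beta>\<bar> + norm w * B + \<bar>\<alpha>\<bar> + norm u * B"
      using at ux wx by linarith
    with xB show ?thesis by simp
  qed
  have "bounded K"
    unfolding bounded_iff
  proof (intro exI ballI)
    fix p assume "p \<in> K"
    then show "norm p \<le> B + (\<bar>M - \<beta>\<bar> + norm w * B + \<bar>\<alpha>\<bar> + norm u * B)"
      using bd[of "fst p" "snd p"] norm_Pair_le[of "fst p" "snd p"] by auto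
  qed
  then have "compact K" using clK compact_eq_bounded_closed by blast
  moreover have "(x1, r1) \<in> K"
    by (simp add: K_def ext_epigraph_def r1 M_def)
  ultimately obtain p where p: "p \<in> K" "\<forall>p'\<in>K. snd p + q (fst p) \<le> snd p' + q (fst p')"
    using continuous_attains_inf[of K, OF _ _ continuous_on_subset[OF cont subset_UNIV]] by blast
  obtain x t where xt: "p = (x, t)" by force
  have ft: "f x \<le> ereal t" and tM: "t + q x \<le> M"
    using p(1) by (auto simp: xt K_def ext_epigraph_def)
  \<comment> \<open>Back from the epigraph to \<open>f\<close>: a finite competitor either lies in
    \<open>K\<close>, or its value exceeds \<open>M\<close>, which already bounds the value at
    \<open>p\<close>.\<close>
  have "f x + ereal (q x) \<le> f y + ereal (q y)" for y
  proof -
    have "f x + ereal (q x) \<le> ereal (t + q x)"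
      using add_right_mono[OF ft, of "ereal (q x)"] by simp
    also have "\<dots> \<le> f y + ereal (q y)"
    proof (cases "f y")
      case (real s)
      show ?thesis
      proof (cases "s + q y \<le> M")
        case True
        then have "(y, s) \<in> K" by (simp add: K_def ext_epigraph_def real)
        with p(2) show ?thesis by (auto simp: xt real)
      qed (use tM real in auto)
    qed (use f in \<open>auto simp: proper_fun_def\<close>)
    finally show ?thesis .
  qed
  then show ?thesis by blast
qed

text \<open>Two solutions are points where the strongly monotone operator takes the common value
  \<open>- b\<close>, so they coincide. For existence the inclusion is perturbed by
  \<open>x - a\<close>, and a fixed point of the solution map is a place where the perturbation
  vanishes.\<close>

lemma strongly_monotone_subdifferential_unique_zero:
  fixes f :: "'a::euclidean_space \<Rightarrow> ereal" and H :: "'a \<Rightarrow> 'a"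
  assumes f: "proper_closed_convex f" and ne: "subdifferential f x1 \<noteq> {}"
    and H: "selfadjoint_psd H"
    and sm: "strongly_monotone (\<lambda>x. (\<lambda>u. u + H x) ` subdifferential f x)"
  shows "\<exists>!x. - (H x + b) \<in> subdifferential f x"
proof -
  have pf: "proper_fun f" "convex (ext_epigraph f)" "closed (ext_epigraph f)"
    using f by (auto simp: proper_closed_convex_def)
  have lin: "linear H" and pos: "\<And>x. 0 \<le> x \<bullet> H x" and adj: "\<And>x y. x \<bullet> H y = H x \<bullet> y"
    using H adjoint_works[of H] by (auto simp: selfadjoint_psd_def)
  obtain \<mu> where \<mu>: "\<mu> > 0" and mono: "\<And>x y u v. u \<in> subdifferential f x \<Longrightarrow> v \<in> subdifferential f y
      \<Longrightarrow> \<mu> * (norm (x - y))\<^sup>2 \<le> ((u + H x) - (v + H y)) \<bullet> (x - y)"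
    using sm unfolding strongly_monotone_def by blast
  obtain s where s: "s \<in> subdifferential f x1" using ne by auto
  obtain r1 where r1: "f x1 = ereal r1"
    using proper_finite_on_subdifferential[OF pf(1) s] .
  have minor: "ereal ((r1 - s \<bullet> x1) + s \<bullet> x) \<le> f x" for x
    using s by (auto simp: subdifferential_def r1 inner_diff_right algebra_simps dest!: spec[of _ x])
  \<comment> \<open>The term \<open>x - a\<close> is the gradient of half the squared distance to
    \<open>a\<close>. It supplies the quadratic growth that the form of a merely semidefinite
    \<open>H\<close> may lack, and it adds the identity to the Hessian.\<close>
  have prox: "\<exists>x. - (H x + b + (x - a)) \<in> subdifferential f x" for a
  proof -
    define q where "q x = 1 / 2 * (x \<bullet> H x) + b \<bullet> x + 1 / 2 * (norm (x - a))\<^sup>2" for x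
    have cont: "continuous_on UNIV q"
      unfolding q_def by (intro continuous_intros linear_continuous_on)
        (simp_all add: lin linear_conv_bounded_linear[symmetric])
    have lower: "1 / 2 * (norm a)\<^sup>2 + (b - a) \<bullet> x + 1 / 2 * (norm x)\<^sup>2 \<le> q x" for x
      using pos[of x]
      by (simp add: q_def power2_norm_eq_inner inner_diff_left inner_diff_right inner_commute
          algebra_simps)
    obtain x where x: "\<forall>y. f x + ereal (q x) \<le> f y + ereal (q y)"
      using affine_minorant_minimizer_exists[OF pf(1,3) minor cont lower] by blast
    have "q y = q x + (H x + b + (x - a)) \<bullet> (y - x)
        + 1 / 2 * ((y - x) \<bullet> (H (y - x) + (y - x)))" for x y
      using adj[of x y]
      by (simp add: q_def power2_norm_eq_inner inner_simps linear_diff[OF lin] inner_commute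
          field_simps)
    then have "- (H x + b + (x - a)) \<in> subdifferential f x"
      using minimizer_iff_subgradient[of f "\<lambda>v. H v + v" q x "\<lambda>x. H x + b + (x - a)"] pf x pos
      by (simp add: linear_compose_add[OF lin linear_ident] inner_add_right)
    then show ?thesis by blast
  qed
  define P where "P a = (SOME x. - (H x + b + (x - a)) \<in> subdifferential f x)" for a
  have P: "- (H (P a) + b + (P a - a)) \<in> subdifferential f (P a)" for a
    unfolding P_def using someI_ex[OF prox] .
  \<comment> \<open>Strong monotonicity is applied to the inclusions at \<open>P a\<close> and
    \<open>P a'\<close>: \<open>b\<close> cancels, and the operator values differ by
    \<open>(a - a') - (P a - P a')\<close>. Moving the last term to the left turns the modulus \<mu>
    into 1 + \<mu>.\<close>
  have contr: "dist (P a) (P a') \<le> 1 / (1 + \<mu>) * dist a a'" for a a'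
  proof -
    let ?n = "norm (P a - P a')"
    have "\<mu> * ?n\<^sup>2 \<le> ((a - a') - (P a - P a')) \<bullet> (P a - P a')"
      using mono[OF P[of a] P[of a']] by (simp add: algebra_simps)
    then have "(1 + \<mu>) * ?n\<^sup>2 \<le> (a - a') \<bullet> (P a - P a')"
      by (simp add: power2_norm_eq_inner inner_diff_left algebra_simps)
    also have "\<dots> \<le> norm (a - a') * ?n" by (rule norm_cauchy_schwarz)
    finally have "((1 + \<mu>) * ?n) * ?n \<le> norm (a - a') * ?n"
      by (simp add: power2_eq_square mult.assoc)
    then have "(1 + \<mu>) * ?n \<le> norm (a - a')"
      by (cases "?n = 0") (simp_all add: mult_le_cancel_right)
    then show ?thesis using \<mu> by (simp add: dist_norm field_simps)
  qed
  have "\<exists>!a. P a = a"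
    by (rule banach_fix_type[where c = "1 / (1 + \<mu>)"]) (use contr \<mu> in auto)
  then obtain a where "P a = a" by blast
  then have "- (H a + b) \<in> subdifferential f a" using P[of a] by simp
  moreover have "x = y"
    if "- (H x + b) \<in> subdifferential f x" "- (H y + b) \<in> subdifferential f y" for x y
  proof -
    have "\<mu> * (norm (x - y))\<^sup>2 \<le> 0" using mono[OF that] by simp
    with \<mu> show ?thesis by (simp add: mult_le_0_iff)
  qed
  ultimately show ?thesis by blast
qed

section \<open>The two ADMM subproblems\<close>

lemma selfadjoint_psd_gram_add:
  fixes F :: "'a::euclidean_space \<Rightarrow> 'c::euclidean_space"
  assumes "linear F" "selfadjoint_psd S" "0 \<le> \<sigma>"
  shows "selfadjoint_psd (\<lambda>x. \<sigma> *\<^sub>R adjoint F (F x) + S x)"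
proof -
  have S: "linear S" "\<And>x y. x \<bullet> S y = S x \<bullet> y" "\<And>x. 0 \<le> x \<bullet> S x"
    using assms(2) adjoint_works[of S] by (auto simp: selfadjoint_psd_def)
  have lin: "linear (\<lambda>x. \<sigma> *\<^sub>R adjoint F (F x) + S x)"
    using linear_compose[OF assms(1) adjoint_linear[OF assms(1)]] S(1)
    by (intro linear_compose_add linear_compose_scale_right) (auto simp: o_def)
  moreover have "adjoint (\<lambda>x. \<sigma> *\<^sub>R adjoint F (F x) + S x) = (\<lambda>x. \<sigma> *\<^sub>R adjoint F (F x) + S x)"
    by (rule adjoint_unique)
      (simp add: inner_add_left inner_add_right adjoint_works[OF assms(1)]
        adjoint_clauses[OF assms(1)] S(2))
  moreover have "0 \<le> x \<bullet> (\<sigma> *\<^sub>R adjoint F (F x) + S x)" for x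
    using assms(3) S(3) by (simp add: inner_add_right adjoint_works[OF assms(1)])
  ultimately show ?thesis by (simp add: selfadjoint_psd_def)
qed

lemma prox_lagrangian_argmin_iff:
  fixes h :: "'a::euclidean_space \<Rightarrow> ereal" and A :: "'a \<Rightarrow> 'c::euclidean_space"
    and S :: "'a \<Rightarrow> 'a" and p :: 'a and z e :: 'c and k \<sigma> :: real
  assumes h: "proper_closed_convex h" "subdifferential h x1 \<noteq> {}"
    and A: "linear A" and S: "selfadjoint_psd S" and "\<sigma> > 0"
    and sm: "strongly_monotone
           (\<lambda>x. (\<lambda>u. u + \<sigma> *\<^sub>R adjoint A (A x) + S x) ` subdifferential h x)"
  defines "\<Phi> \<equiv> \<lambda>x. h x + ereal (k + z \<bullet> (A x + e) + \<sigma> / 2 * (norm (A x + e))\<^sup>2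
             + 1 / 2 * (op_norm S (x - p))\<^sup>2)"
    and "d \<equiv> \<lambda>x. adjoint A z + \<sigma> *\<^sub>R adjoint A (A x + e) + S (x - p)"
  shows "argmin_set \<Phi> = {xb} \<longleftrightarrow> - d xb \<in> subdifferential h xb"
    and "\<exists>!x. - d x \<in> subdifferential h x"
proof -
  define H where "H = (\<lambda>x. \<sigma> *\<^sub>R adjoint A (A x) + S x)"
  define q where "q x = k + z \<bullet> (A x + e) + \<sigma> / 2 * (norm (A x + e))\<^sup>2
             + 1 / 2 * (op_norm S (x - p))\<^sup>2" for x
  have H: "selfadjoint_psd H"
    unfolding H_def using selfadjoint_psd_gram_add A S \<open>\<sigma> > 0\<close> by force
  have S': "linear S" "\<And>x y. x \<bullet> S y = S x \<bullet> y" "\<And>x. 0 \<le> x \<bullet> S x"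
    using S adjoint_works[of S] by (auto simp: selfadjoint_psd_def)
  have Aa: "linear (adjoint A)" using A by (rule adjoint_linear)
  \<comment> \<open>Separates the linear part of the gradient from its constant part, which plays
    the role of \<open>b\<close> in the solvability lemma.\<close>
  have d: "d x = H x + (adjoint A z + \<sigma> *\<^sub>R adjoint A e - S p)" for x
    by (simp add: d_def H_def linear_add[OF Aa] linear_diff[OF S'(1)] algebra_simps)
  show ex1: "\<exists>!x. - d x \<in> subdifferential h x"
    unfolding d using sm
    by (intro strongly_monotone_subdifferential_unique_zero[OF h H]) (simp add: H_def add.assoc)
  have expand: "q y = q x + d x \<bullet> (y - x) + 1 / 2 * ((y - x) \<bullet> H (y - x))" for x y
  proof -
    define v where "v = y - x"
    have y: "y = x + v" by (simp add: v_def)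
    have op: "(op_norm S w)\<^sup>2 = w \<bullet> S w" for w
      using S'(3) by (simp add: op_norm_def)
    have s: "S (x + v - p) = S (x - p) + S v"
      by (simp add: linear_add[OF S'(1)] linear_diff[OF S'(1)])
    have sv: "(x - p) \<bullet> S v = v \<bullet> S (x - p)"
      using S'(2)[of "x - p" v] by (simp add: inner_commute)
    have "(op_norm S (x + v - p))\<^sup>2
        = (op_norm S (x - p))\<^sup>2 + 2 * (S (x - p) \<bullet> v) + v \<bullet> S v"
    proof -
      have "x + v - p = (x - p) + v" by simp
      then show ?thesis
        unfolding op s by (simp only: inner_add_left inner_add_right sv) (simp add: inner_commute)
    qed
    moreover have "(norm (A (x + v) + e))\<^sup>2
        = (norm (A x + e))\<^sup>2 + 2 * ((A x + e) \<bullet> A v) + A v \<bullet> A v"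
      by (simp add: power2_norm_eq_inner linear_add[OF A] inner_simps inner_commute)
    moreover have "z \<bullet> (A (x + v) + e) = z \<bullet> (A x + e) + z \<bullet> A v"
      by (simp add: linear_add[OF A] inner_simps)
    moreover have "d x \<bullet> v = z \<bullet> A v + \<sigma> * ((A x + e) \<bullet> A v) + S (x - p) \<bullet> v"
      unfolding d_def inner_add_left inner_scaleR_left adjoint_clauses[OF A] ..
    moreover have "v \<bullet> H v = \<sigma> * (A v \<bullet> A v) + v \<bullet> S v"
      by (simp add: H_def inner_add_right adjoint_works[OF A])
    ultimately show ?thesis
      unfolding y q_def by (simp add: field_simps)
  qed
  have "x \<in> argmin_set \<Phi> \<longleftrightarrow> - d x \<in> subdifferential h x" for x
  proof -
    have "x \<in> argmin_set \<Phi> \<longleftrightarrow> (\<forall>y. h x + ereal (q x) \<le> h y + ereal (q y))"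
      by (simp add: argmin_set_def is_arg_min_linorder \<Phi>_def q_def)
    then show ?thesis
      using minimizer_iff_subgradient[of h H q x d, OF _ _ _ _ expand] h(1) H
      by (simp add: proper_closed_convex_def selfadjoint_psd_def)
  qed
  with ex1 show "argmin_set \<Phi> = {xb} \<longleftrightarrow> - d xb \<in> subdifferential h xb"
    by blast
qed

section \<open>Equivalence of the two schemes\<close>

lemma zero_in_translate_iff:
  "(0::'a::monoid_add) \<in> (\<lambda>t. t + m) ` {E u v | u v. R u v} \<longleftrightarrow> (\<exists>u v. R u v \<and> E u v + m = 0)"
  by (auto simp: image_iff)

theorem propositionB1:
  fixes f :: "'a::euclidean_space \<Rightarrow> ereal"
    and g :: "'b::euclidean_space \<Rightarrow> ereal"
    and F :: "'a \<Rightarrow> 'c::euclidean_space"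
    and G :: "'b \<Rightarrow> 'c"
    and c :: 'c
    and S1 :: "'a \<Rightarrow> 'a"
    and S2 :: "'b \<Rightarrow> 'b"
    and \<sigma> \<rho> :: real
    and x0 :: 'a and y0 :: 'b and z0 :: 'c
  assumes "proper_closed_convex f"
    and "proper_closed_convex g"
    and "linear F"
    and "linear G"
    and "\<exists>w. 0 \<in> kkt_operator f g F G c w"
    and "\<sigma> > 0"
    and "selfadjoint_psd S1"
    and "selfadjoint_psd S2"
    and "maximal_monotone
           (\<lambda>x. (\<lambda>u. u + \<sigma> *\<^sub>R adjoint F (F x) + S1 x) ` subdifferential f x)"
    and "strongly_monotone
           (\<lambda>x. (\<lambda>u. u + \<sigma> *\<^sub>R adjoint F (F x) + S1 x) ` subdifferential f x)"
    and "maximal_monotone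
           (\<lambda>y. (\<lambda>v. v + \<sigma> *\<^sub>R adjoint G (G y) + S2 y) ` subdifferential g y)"
    and "strongly_monotone
           (\<lambda>y. (\<lambda>v. v + \<sigma> *\<^sub>R adjoint G (G y) + S2 y) ` subdifferential g y)"
    and "x0 \<in> effective_domain f"
    and "y0 \<in> effective_domain g"
  shows "(\<exists>!(wb, wp). gsp_admm_step f g F G c \<sigma> S1 S2 \<rho> (x0, y0, z0) wb wp) \<and>
         (\<forall>wb wp. gsp_admm_step f g F G c \<sigma> S1 S2 \<rho> (x0, y0, z0) wb wp \<longleftrightarrow>
                  prox_point_step f g F G c \<sigma> S1 S2 \<rho> (x0, y0, z0) wb wp)"
proof -
  obtain x1 y1 where ne: "subdifferential f x1 \<noteq> {}" "subdifferential g y1 \<noteq> {}"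
    using assms(5) by (auto simp: kkt_operator_def)
  have pf: "proper_fun f" and pg: "proper_fun g"
    using assms by (auto simp: proper_closed_convex_def)
  \<comment> \<open>In the x-subproblem \<open>g y0\<close> is an additive constant. Its finiteness
    lets it be absorbed into the real parameter \<open>k\<close>.\<close>
  obtain r0 where r0: "g y0 = ereal r0"
    using pg \<open>y0 \<in> effective_domain g\<close>
    by (cases "g y0") (auto simp: proper_fun_def effective_domain_def)
  define dx where "dx x = adjoint F z0 + \<sigma> *\<^sub>R adjoint F (F x + (G y0 - c)) + S1 (x - x0)" for x
  define dy where "dy xb zb y =
    adjoint G zb + \<sigma> *\<^sub>R adjoint G (G y + (F xb - c)) + S2 (y - y0)" for xb zb y
  note X = prox_lagrangian_argmin_iff[OF assms(1) ne(1) assms(3,7,6,10),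
      where z = z0 and e = "G y0 - c" and p = x0, folded dx_def]
  note Y = prox_lagrangian_argmin_iff[OF assms(2) ne(2) assms(4,8,6,12),
      where p = y0 and z = zb and e = "F xb - c" for xb zb, folded dy_def]
  have xstep: "argmin_set (\<lambda>x. aug_lagrangian f g F G c \<sigma> x y0 z0
      + ereal (1 / 2 * (op_norm S1 (x - x0))\<^sup>2)) = {xb} \<longleftrightarrow> - dx xb \<in> subdifferential f xb" for xb
  proof -
    have "(\<lambda>x. aug_lagrangian f g F G c \<sigma> x y0 z0 + ereal (1 / 2 * (op_norm S1 (x - x0))\<^sup>2))
      = (\<lambda>x. f x + ereal (r0 + z0 \<bullet> (F x + (G y0 - c)) + \<sigma> / 2 * (norm (F x + (G y0 - c)))\<^sup>2
             + 1 / 2 * (op_norm S1 (x - x0))\<^sup>2))"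
      by (simp add: aug_lagrangian_def r0 add.assoc add_diff_eq)
    then show ?thesis using X(1) by simp
  qed
  \<comment> \<open>Here the constant is \<open>f xb\<close>, which need not be finite for arbitrary
    \<open>xb\<close>. A subgradient at \<open>xb\<close> guarantees finiteness, and in
    \<open>admm\<close> the x-step inclusion provides one.\<close>
  have ystep: "argmin_set (\<lambda>y. aug_lagrangian f g F G c \<sigma> xb y zb
      + ereal (1 / 2 * (op_norm S2 (y - y0))\<^sup>2)) = {yb} \<longleftrightarrow> - dy xb zb yb \<in> subdifferential g yb"
    if fin: "v \<in> subdifferential f xb" for xb yb zb v
  proof -
    obtain r where r: "f xb = ereal r"
      using proper_finite_on_subdifferential[OF pf fin] .
    have "(\<lambda>y. aug_lagrangian f g F G c \<sigma> xb y zb + ereal (1 / 2 * (op_norm S2 (y - y0))\<^sup>2))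
      = (\<lambda>y. g y + ereal (r + zb \<bullet> (G y + (F xb - c)) + \<sigma> / 2 * (norm (G y + (F xb - c)))\<^sup>2
             + 1 / 2 * (op_norm S2 (y - y0))\<^sup>2))"
    proof
      fix y
      have eq: "F xb + G y - c = G y + (F xb - c)" by simp
      then show "aug_lagrangian f g F G c \<sigma> xb y zb + ereal (1 / 2 * (op_norm S2 (y - y0))\<^sup>2)
        = g y + ereal (r + zb \<bullet> (G y + (F xb - c)) + \<sigma> / 2 * (norm (G y + (F xb - c)))\<^sup>2
             + 1 / 2 * (op_norm S2 (y - y0))\<^sup>2)"
        by (cases "g y") (simp_all add: aug_lagrangian_def r eq)
    qed
    then show ?thesis using Y(1) by simp
  qed
  have admm: "gsp_admm_step f g F G c \<sigma> S1 S2 \<rho> (x0, y0, z0) (xb, yb, zb) wp \<longleftrightarrow>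
      - dx xb \<in> subdifferential f xb \<and> zb = z0 + \<sigma> *\<^sub>R (F xb + G y0 - c) \<and>
      - dy xb zb yb \<in> subdifferential g yb \<and>
      wp = (1 - \<rho>) *\<^sub>R (x0, y0, z0) + \<rho> *\<^sub>R (xb, yb, zb)" for xb yb zb wp
    unfolding gsp_admm_step_def prod.case xstep using ystep by blast
  have lF: "linear (adjoint F)" and lG: "linear (adjoint G)"
    using assms(3,4) by (auto intro: adjoint_linear)
  have prox: "prox_point_step f g F G c \<sigma> S1 S2 \<rho> (x0, y0, z0) (xb, yb, zb) wp \<longleftrightarrow>
      - dx xb \<in> subdifferential f xb \<and> zb = z0 + \<sigma> *\<^sub>R (F xb + G y0 - c) \<and>
      - dy xb zb yb \<in> subdifferential g yb \<and>
      wp = (1 - \<rho>) *\<^sub>R (x0, y0, z0) + \<rho> *\<^sub>R (xb, yb, zb)" for xb yb zb wp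
  proof -
    \<comment> \<open>\<open>ex\<close> and \<open>ey\<close> are what the first two blocks of the
      proximal point inclusion add to the subgradients.\<close>
    define ex where "ex = adjoint F zb + S1 (xb - x0)"
    define ey where "ey = adjoint G zb + \<sigma> *\<^sub>R adjoint G (G (yb - y0)) + S2 (yb - y0)
      + adjoint G (zb - z0)"
    \<comment> \<open>The terms in \<open>G yb\<close> cancel, so the third block is the multiplier
      update divided by \<sigma>.\<close>
    have third: "c - F xb - G yb + (G (yb - y0) + (1 / \<sigma>) *\<^sub>R (zb - z0)) = 0
        \<longleftrightarrow> zb = z0 + \<sigma> *\<^sub>R (F xb + G y0 - c)"
    proof -
      have "c - F xb - G yb + (G (yb - y0) + (1 / \<sigma>) *\<^sub>R (zb - z0)) = 0
          \<longleftrightarrow> (1 / \<sigma>) *\<^sub>R (zb - z0) = F xb + G y0 - c"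
        by (auto simp: linear_diff[OF assms(4)] algebra_simps)
      also have "\<dots> \<longleftrightarrow> zb - z0 = \<sigma> *\<^sub>R (F xb + G y0 - c)"
        using \<open>\<sigma> > 0\<close> by (auto simp: eq_vector_fraction_iff vector_fraction_eq_iff)
      finally show ?thesis by (auto simp: algebra_simps)
    qed
    have "0 \<in> (\<lambda>t. t + prox_metric G \<sigma> S1 S2 ((xb, yb, zb) - (x0, y0, z0)))
        ` kkt_operator f g F G c (xb, yb, zb) \<longleftrightarrow>
      (\<exists>u v. u \<in> subdifferential f xb \<and> v \<in> subdifferential g yb \<and> u + ex = 0 \<and> v + ey = 0 \<and>
        c - F xb - G yb + (G (yb - y0) + (1 / \<sigma>) *\<^sub>R (zb - z0)) = 0)"
    proof -
      show ?thesis
        unfolding kkt_operator_def prox_metric_def prod.case zero_in_translate_iff ex_def ey_def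
        by (simp add: zero_in_translate_iff zero_prod_def add.assoc conj_assoc)
    qed
    also have "\<dots> \<longleftrightarrow> - ex \<in> subdifferential f xb \<and> - ey \<in> subdifferential g yb \<and>
        zb = z0 + \<sigma> *\<^sub>R (F xb + G y0 - c)"
      unfolding third by (auto simp: add_eq_0_iff2)
    also have "\<dots> \<longleftrightarrow> - dx xb \<in> subdifferential f xb \<and> zb = z0 + \<sigma> *\<^sub>R (F xb + G y0 - c) \<and>
        - dy xb zb yb \<in> subdifferential g yb"
    proof -
      \<comment> \<open>The update turns \<open>adjoint F zb\<close> into the multiplier and penalty
        terms at \<open>z0\<close>. In the y-block, \<open>adjoint G (zb - z0)\<close> contributes
        the residual at \<open>(xb, y0)\<close>, and \<open>G (yb - y0)\<close> shifts it to the
        residual at \<open>(xb, yb)\<close>.\<close>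
      have "ex = dx xb \<and> ey = dy xb zb yb" if zb: "zb = z0 + \<sigma> *\<^sub>R (F xb + G y0 - c)"
      proof
        show "ex = dx xb"
          unfolding ex_def dx_def zb
          by (simp add: linear_add[OF lF] linear_scale[OF lF] add_diff_eq)
        have "adjoint G (zb - z0) = \<sigma> *\<^sub>R adjoint G (F xb + G y0 - c)"
          by (simp add: zb linear_scale[OF lG])
        then show "ey = dy xb zb yb"
          unfolding ey_def dy_def
          by (simp add: linear_add[OF lG] linear_diff[OF lG] linear_diff[OF assms(4)]
              algebra_simps)
      qed
      then show ?thesis by auto
    qed
    finally show ?thesis unfolding prox_point_step_def by blast
  qed
  \<comment> \<open>The conditions are triangular: the first fixes \<open>xb\<close>, the update
    then fixes \<open>zb\<close>, and only then does the y-inclusion determine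
    \<open>yb\<close>.\<close>
  obtain xb where xb: "- dx xb \<in> subdifferential f xb"
      "\<And>x. - dx x \<in> subdifferential f x \<Longrightarrow> x = xb"
    using X(2) by blast
  define zb where "zb = z0 + \<sigma> *\<^sub>R (F xb + G y0 - c)"
  obtain yb where yb: "- dy xb zb yb \<in> subdifferential g yb"
      "\<And>y. - dy xb zb y \<in> subdifferential g y \<Longrightarrow> y = yb"
    using Y(2) by blast
  have iff: "gsp_admm_step f g F G c \<sigma> S1 S2 \<rho> (x0, y0, z0) wb wp \<longleftrightarrow>
      wb = (xb, yb, zb) \<and> wp = (1 - \<rho>) *\<^sub>R (x0, y0, z0) + \<rho> *\<^sub>R (xb, yb, zb)" for wb wp
  proof (cases wb)
    case (fields x y z)
    have "- dx x \<in> subdifferential f x \<longleftrightarrow> x = xb"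
      and "- dy xb zb y \<in> subdifferential g y \<longleftrightarrow> y = yb"
      using xb yb by blast+
    then show ?thesis
      unfolding fields admm prod.inject by (metis zb_def)
  qed
  have "\<exists>!(wb, wp). gsp_admm_step f g F G c \<sigma> S1 S2 \<rho> (x0, y0, z0) wb wp"
    unfolding iff by auto
  moreover have "gsp_admm_step f g F G c \<sigma> S1 S2 \<rho> (x0, y0, z0) wb wp \<longleftrightarrow>
      prox_point_step f g F G c \<sigma> S1 S2 \<rho> (x0, y0, z0) wb wp" for wb wp
    by (cases wb) (simp only: admm prox)
  ultimately show ?thesis by blast
qed

end
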